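(* The cocomparison functor $H:\mathbf{DIF}\to\mathbf{ALG}_{\mathbf C}$ is an isomorphism of categories, i.e., $\mathbf{DIF}$ is comonadic over $\mathbf{ALG}$.
   Context: Fix a commutative ring $\mathbf k$ with identity and $\lambda\in\mathbf k$. All algebras are commutative $\mathbf k$-algebras with identity and algebra homomorphisms preserve the identity. $\mathbf{ALG}$ is the category of such algebras; $\mathbb N=\{0,1,2,\dots\}$. A $\lambda$-derivation on an algebra $R$ is a $\mathbf k$-linear map $d:R\to R$ with $d(xy)=d(x)y+xd(y)+\lambda d(x)d(y)$ for all $x,y\in R$ and $d(\mathbf 1_R)=0$; $(R,d)$ is then a $\lambda$-differential algebra. A homomorphism $(R,d)\to(S,e)$ is an algebra homomorphism $f$ with $f\circ d=e\circ f$. $\mathbf{DIF}$ is the resulting category and $V:\mathbf{DIF}\to\mathbf{ALG}$, $V(R,d)=R$, the forgetful functor. For an algebra $A$, $A^{\mathbb N}$ is the algebra of all functions $\mathbb N\to A$ with the $\lambda$-Hurwitz product $(fg)(n)=\sum_{k=0}^n\sum_{j=0}^{n-k}\binom nk\binom{n-k}j\lambda^kf(n-j)g(k+j)$, and $\partial_A(f)(n)=f(n+1)$ is a $\lambda$-derivation on it. For an algebra homomorphism $h:A\to B$, $h^{\mathbb N}(f)(n)=h(f(n))$. It is known that $G(A)=(A^{\mathbb N},\partial_A)$, $G(h)=h^{\mathbb N}$, is right adjoint to $V$, with unit $(\eta_{(R,d)}(x))(n)=d^{(n)}(x)$ ($n$-fold iterate) and counit $\varepsilon_A(f)=f(0)$.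 This adjunction gives the comonad $\mathbf C=\langle C,\varepsilon,\delta\rangle$ on $\mathbf{ALG}$ with $C=VG$ (so $C(A)=A^{\mathbb N}$) and $\delta=V\eta G$, i.e. $(\delta_A(f)(m))(n)=f(m+n)$. $\mathbf{ALG}_{\mathbf C}$ is the category of $\mathbf C$-coalgebras: objects are pairs $\langle A,f\rangle$ with $f:A\to A^{\mathbb N}$ an algebra homomorphism such that $\varepsilon_A\circ f=\mathrm{id}_A$ and $\delta_A\circ f=f^{\mathbb N}\circ f$; morphisms $\langle A,f\rangle\to\langle B,g\rangle$ are algebra homomorphisms $\varphi:A\to B$ with $g\circ\varphi=\varphi^{\mathbb N}\circ f$. The cocomparison functor $H$ is given by $H(R,d)=\langle R,\tilde d\rangle$, where $\tilde d=V(\eta_{(R,d)}):R\to R^{\mathbb N}$, $(\tilde d(a))(n)=d^{(n)}(a)$, and is the identity on underlying algebra homomorphisms. *)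

theory Defs
  imports Complex_Main "HOL-Algebra.Module"
begin

text \<open>
  Categories are given by hom-sets. The hom-sets of different pairs of objects need not be
  disjoint, so an arrow is determined by its source, its target and a member of the hom-set, and
  composition \<open>Cmp \<C> X Y Z g f\<close> (first \<open>f : X \<rightarrow> Y\<close>, then \<open>g : Y \<rightarrow> Z\<close>) takes the objects as arguments.
\<close>

record ('o, 'm) cat =
  Obj :: "'o set"
  Hom :: "'o \<Rightarrow> 'o \<Rightarrow> 'm set"
  Idt :: "'o \<Rightarrow> 'm"
  Cmp :: "'o \<Rightarrow> 'o \<Rightarrow> 'o \<Rightarrow> 'm \<Rightarrow> 'm \<Rightarrow> 'm"

definition category :: "('o, 'm) cat \<Rightarrow> bool" where
  "category \<C> \<longleftrightarrow>
     (\<forall>X\<in>Obj \<C>. Idt \<C> X \<in> Hom \<C> X X) \<and>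
     (\<forall>X\<in>Obj \<C>. \<forall>Y\<in>Obj \<C>. \<forall>Z\<in>Obj \<C>. \<forall>f\<in>Hom \<C> X Y. \<forall>g\<in>Hom \<C> Y Z.
        Cmp \<C> X Y Z g f \<in> Hom \<C> X Z) \<and>
     (\<forall>X\<in>Obj \<C>. \<forall>Y\<in>Obj \<C>. \<forall>f\<in>Hom \<C> X Y.
        Cmp \<C> X X Y f (Idt \<C> X) = f \<and> Cmp \<C> X Y Y (Idt \<C> Y) f = f) \<and>
     (\<forall>W\<in>Obj \<C>. \<forall>X\<in>Obj \<C>. \<forall>Y\<in>Obj \<C>. \<forall>Z\<in>Obj \<C>.
        \<forall>f\<in>Hom \<C> W X. \<forall>g\<in>Hom \<C> X Y. \<forall>h\<in>Hom \<C> Y Z.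
          Cmp \<C> W Y Z h (Cmp \<C> W X Y g f) = Cmp \<C> W X Z (Cmp \<C> X Y Z h g) f)"

record ('o, 'm, 'p, 'n) ftr =
  fobj :: "'o \<Rightarrow> 'p"
  fmap :: "'o \<Rightarrow> 'o \<Rightarrow> 'm \<Rightarrow> 'n"

definition is_functor :: "('o, 'm) cat \<Rightarrow> ('p, 'n) cat \<Rightarrow> ('o, 'm, 'p, 'n) ftr \<Rightarrow> bool" where
  "is_functor \<C> \<D> F \<longleftrightarrow> category \<C> \<and> category \<D> \<and>
     (\<forall>X\<in>Obj \<C>. fobj F X \<in> Obj \<D>) \<and>
     (\<forall>X\<in>Obj \<C>. \<forall>Y\<in>Obj \<C>. \<forall>f\<in>Hom \<C> X Y. fmap F X Y f \<in> Hom \<D> (fobj F X) (fobj F Y)) \<and>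
     (\<forall>X\<in>Obj \<C>. fmap F X X (Idt \<C> X) = Idt \<D> (fobj F X)) \<and>
     (\<forall>X\<in>Obj \<C>. \<forall>Y\<in>Obj \<C>. \<forall>Z\<in>Obj \<C>. \<forall>f\<in>Hom \<C> X Y. \<forall>g\<in>Hom \<C> Y Z.
        fmap F X Z (Cmp \<C> X Y Z g f)
          = Cmp \<D> (fobj F X) (fobj F Y) (fobj F Z) (fmap F Y Z g) (fmap F X Y f))"

definition comp_ftr ::
    "('p, 'n, 'q, 'l) ftr \<Rightarrow> ('o, 'm, 'p, 'n) ftr \<Rightarrow> ('o, 'm, 'q, 'l) ftr" where
  "comp_ftr G F = \<lparr> fobj = (\<lambda>X. fobj G (fobj F X)),
     fmap = (\<lambda>X Y f. fmap G (fobj F X) (fobj F Y) (fmap F X Y f)) \<rparr>"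

text \<open>Equality with the identity functor is only required on the objects and arrows of the category.\<close>

definition is_identity_ftr :: "('o, 'm) cat \<Rightarrow> ('o, 'm, 'o, 'm) ftr \<Rightarrow> bool" where
  "is_identity_ftr \<C> F \<longleftrightarrow>
     (\<forall>X\<in>Obj \<C>. fobj F X = X) \<and>
     (\<forall>X\<in>Obj \<C>. \<forall>Y\<in>Obj \<C>. \<forall>f\<in>Hom \<C> X Y. fmap F X Y f = f)"

definition isomorphism_of_categories ::
    "('o, 'm) cat \<Rightarrow> ('p, 'n) cat \<Rightarrow> ('o, 'm, 'p, 'n) ftr \<Rightarrow> bool" where
  "isomorphism_of_categories \<C> \<D> F \<longleftrightarrow> is_functor \<C> \<D> F \<and>
     (\<exists>F'. is_functor \<D> \<C> F' \<and>
        is_identity_ftr \<C> (comp_ftr F' F) \<and> is_identity_ftr \<D> (comp_ftr F F'))"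


text \<open>
  A commutative unital algebra over \<open>K\<close> is an instance of the locale \<open>algebra\<close>, with
  carrier a subset of the type \<open>'a\<close>. The category of algebras in the
  universe \<open>'a\<close> has these as objects; as \<open>'a\<close> is a type variable, nothing restricts the size of
  the algebras. Maps between carriers are extensional (\<open>undefined\<close> off the domain), so that
  equality of HOL functions is equality of maps. They are defined between different
  universes, because the function algebra over \<open>A\<close> lives in the universe \<open>nat \<Rightarrow> 'a\<close>.
\<close>

definition alg_hom ::
    "('k, 'r) ring_scheme \<Rightarrow> ('k, 'a) module \<Rightarrow> ('k, 'b) module \<Rightarrow> ('a \<Rightarrow> 'b) set" where
  "alg_hom K A B = {h \<in> carrier A \<rightarrow>\<^sub>E carrier B. h \<in> ring_hom A B \<and>
     (\<forall>c\<in>carrier K. \<forall>x\<in>carrier A. h (c \<odot>\<^bsub>A\<^esub> x) = c \<odot>\<^bsub>B\<^esub> h x)}"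

definition ALG :: "('k, 'r) ring_scheme \<Rightarrow> (('k, 'a) module, 'a \<Rightarrow> 'a) cat" where
  "ALG K = \<lparr> Obj = {A. algebra K A},
     Hom = alg_hom K,
     Idt = (\<lambda>A. \<lambda>x\<in>carrier A. x),
     Cmp = (\<lambda>A B C g f. compose (carrier A) g f) \<rparr>"

definition lambda_derivation ::
    "('k, 'r) ring_scheme \<Rightarrow> 'k \<Rightarrow> ('k, 'a) module \<Rightarrow> ('a \<Rightarrow> 'a) \<Rightarrow> bool" where
  "lambda_derivation K lam R d \<longleftrightarrow> d \<in> carrier R \<rightarrow>\<^sub>E carrier R \<and>
     (\<forall>x\<in>carrier R. \<forall>y\<in>carrier R. d (x \<oplus>\<^bsub>R\<^esub> y) = d x \<oplus>\<^bsub>R\<^esub> d y) \<and>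
     (\<forall>c\<in>carrier K. \<forall>x\<in>carrier R. d (c \<odot>\<^bsub>R\<^esub> x) = c \<odot>\<^bsub>R\<^esub> d x) \<and>
     (\<forall>x\<in>carrier R. \<forall>y\<in>carrier R.
        d (x \<otimes>\<^bsub>R\<^esub> y)
          = d x \<otimes>\<^bsub>R\<^esub> y \<oplus>\<^bsub>R\<^esub> x \<otimes>\<^bsub>R\<^esub> d y \<oplus>\<^bsub>R\<^esub> lam \<odot>\<^bsub>R\<^esub> (d x \<otimes>\<^bsub>R\<^esub> d y)) \<and>
     d \<one>\<^bsub>R\<^esub> = \<zero>\<^bsub>R\<^esub>"

type_synonym ('k, 'a) dalg = "('k, 'a) module \<times> ('a \<Rightarrow> 'a)"

definition dif_hom ::
    "('k, 'r) ring_scheme \<Rightarrow> ('k, 'a) dalg \<Rightarrow> ('k, 'b) dalg \<Rightarrow> ('a \<Rightarrow> 'b) set" where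
  "dif_hom K X Y = {f \<in> alg_hom K (fst X) (fst Y).
     compose (carrier (fst X)) f (snd X) = compose (carrier (fst X)) (snd Y) f}"

definition DIF :: "('k, 'r) ring_scheme \<Rightarrow> 'k \<Rightarrow> (('k, 'a) dalg, 'a \<Rightarrow> 'a) cat" where
  "DIF K lam = \<lparr> Obj = {(R, d). algebra K R \<and> lambda_derivation K lam R d},
     Hom = dif_hom K,
     Idt = (\<lambda>X. \<lambda>x\<in>carrier (fst X). x),
     Cmp = (\<lambda>X Y Z g f. compose (carrier (fst X)) g f) \<rparr>"

definition V_ftr :: "(('k, 'a) dalg, 'a \<Rightarrow> 'a, ('k, 'a) module, 'a \<Rightarrow> 'a) ftr" where
  "V_ftr = \<lparr> fobj = fst, fmap = (\<lambda>X Y f. f) \<rparr>"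


definition hurwitz_mult ::
    "('k, 'r) ring_scheme \<Rightarrow> 'k \<Rightarrow> ('k, 'a) module \<Rightarrow> (nat \<Rightarrow> 'a) \<Rightarrow> (nat \<Rightarrow> 'a) \<Rightarrow> nat \<Rightarrow> 'a" where
  "hurwitz_mult K lam A f g n =
     (\<Oplus>\<^bsub>A\<^esub>k\<in>{0..n}. \<Oplus>\<^bsub>A\<^esub>j\<in>{0..n - k}.
        add_pow A ((n choose k) * ((n - k) choose j))
          ((lam [^]\<^bsub>K\<^esub> k) \<odot>\<^bsub>A\<^esub> (f (n - j) \<otimes>\<^bsub>A\<^esub> g (k + j))))"

definition hurwitz_alg ::
    "('k, 'r) ring_scheme \<Rightarrow> 'k \<Rightarrow> ('k, 'a) module \<Rightarrow> ('k, nat \<Rightarrow> 'a) module" where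
  "hurwitz_alg K lam A = \<lparr> carrier = {f. \<forall>n. f n \<in> carrier A},
     mult = hurwitz_mult K lam A,
     one = (\<lambda>n. if n = 0 then \<one>\<^bsub>A\<^esub> else \<zero>\<^bsub>A\<^esub>),
     zero = (\<lambda>n. \<zero>\<^bsub>A\<^esub>),
     add = (\<lambda>f g n. f n \<oplus>\<^bsub>A\<^esub> g n),
     smult = (\<lambda>c f n. c \<odot>\<^bsub>A\<^esub> f n) \<rparr>"

definition shift_der ::
    "('k, 'r) ring_scheme \<Rightarrow> 'k \<Rightarrow> ('k, 'a) module \<Rightarrow> (nat \<Rightarrow> 'a) \<Rightarrow> nat \<Rightarrow> 'a" where
  "shift_der K lam A = (\<lambda>f\<in>carrier (hurwitz_alg K lam A). \<lambda>n. f (n + 1))"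

definition hurwitz_map ::
    "('k, 'r) ring_scheme \<Rightarrow> 'k \<Rightarrow> ('k, 'a) module \<Rightarrow> ('a \<Rightarrow> 'b) \<Rightarrow> (nat \<Rightarrow> 'a) \<Rightarrow> nat \<Rightarrow> 'b" where
  "hurwitz_map K lam A h = (\<lambda>f\<in>carrier (hurwitz_alg K lam A). \<lambda>n. h (f n))"

definition G_ftr :: "('k, 'r) ring_scheme \<Rightarrow> 'k \<Rightarrow>
    (('k, 'a) module, 'a \<Rightarrow> 'a, ('k, nat \<Rightarrow> 'a) dalg, (nat \<Rightarrow> 'a) \<Rightarrow> nat \<Rightarrow> 'a) ftr" where
  "G_ftr K lam = \<lparr> fobj = (\<lambda>A. (hurwitz_alg K lam A, shift_der K lam A)),
     fmap = (\<lambda>A B h. hurwitz_map K lam A h) \<rparr>"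

definition eta :: "('k, 'a) dalg \<Rightarrow> 'a \<Rightarrow> nat \<Rightarrow> 'a" where
  "eta X = (\<lambda>x\<in>carrier (fst X). \<lambda>n. (snd X ^^ n) x)"

definition eps ::
    "('k, 'r) ring_scheme \<Rightarrow> 'k \<Rightarrow> ('k, 'a) module \<Rightarrow> (nat \<Rightarrow> 'a) \<Rightarrow> 'a" where
  "eps K lam A = (\<lambda>f\<in>carrier (hurwitz_alg K lam A). f 0)"

text \<open>
  \<open>V\<close> is left adjoint to \<open>G\<close> with unit \<open>eta\<close> and counit \<open>eps\<close>: functoriality, naturality
  and the two triangle identities. The arrow components of the adjunction run between the
  universes \<open>'a\<close> and \<open>nat \<Rightarrow> 'a\<close> (\<open>G (eps A)\<close> even starts in \<open>nat \<Rightarrow> nat \<Rightarrow> 'a\<close>), hence they are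
  stated with the heterogeneous hom-sets and with \<open>hurwitz_map\<close>, the action of \<open>G\<close> on arrows.
\<close>

definition V_adjoint_G :: "('k, 'r) ring_scheme \<Rightarrow> 'k \<Rightarrow> 'a itself \<Rightarrow> bool" where
  "V_adjoint_G K lam (_ :: 'a itself) \<longleftrightarrow>
     (let D = (DIF K lam :: (('k, 'a) dalg, 'a \<Rightarrow> 'a) cat);
          E = (ALG K :: (('k, 'a) module, 'a \<Rightarrow> 'a) cat);
          G = (\<lambda>A. fobj (G_ftr K lam) A :: ('k, nat \<Rightarrow> 'a) dalg)
      in
       is_functor D E V_ftr \<and>
       is_functor E (DIF K lam) (G_ftr K lam) \<and>
       (\<forall>X\<in>Obj D. eta X \<in> dif_hom K X (G (fst X))) \<and>
       (\<forall>X\<in>Obj D. \<forall>Y\<in>Obj D. \<forall>h\<in>Hom D X Y.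
          compose (carrier (fst X)) (eta Y) h
            = compose (carrier (fst X)) (hurwitz_map K lam (fst X) h) (eta X)) \<and>
       (\<forall>A\<in>Obj E. eps K lam A \<in> alg_hom K (fst (G A)) A) \<and>
       (\<forall>A\<in>Obj E. \<forall>B\<in>Obj E. \<forall>h\<in>Hom E A B.
          compose (carrier (fst (G A))) (eps K lam B) (hurwitz_map K lam A h)
            = compose (carrier (fst (G A))) h (eps K lam A)) \<and>
       (\<forall>X\<in>Obj D. compose (carrier (fst X)) (eps K lam (fst X)) (eta X)
          = (\<lambda>x\<in>carrier (fst X). x)) \<and>
       (\<forall>A\<in>Obj E. compose (carrier (fst (G A)))
            (hurwitz_map K lam (fst (G A)) (eps K lam A)) (eta (G A))
          = (\<lambda>f\<in>carrier (fst (G A)). f)))"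


text \<open>
  The comonad \<open>C = VG\<close>, with object part \<open>hurwitz_alg\<close>, arrow part \<open>hurwitz_map\<close>, counit \<open>eps\<close>
  and comultiplication \<open>V\<eta>G\<close>, and its coalgebras.
\<close>

definition delta :: "('k, 'r) ring_scheme \<Rightarrow> 'k \<Rightarrow> ('k, 'a) module \<Rightarrow>
    (nat \<Rightarrow> 'a) \<Rightarrow> nat \<Rightarrow> nat \<Rightarrow> 'a" where
  "delta K lam A = eta (hurwitz_alg K lam A, shift_der K lam A)"

type_synonym ('k, 'a) coalg = "('k, 'a) module \<times> ('a \<Rightarrow> nat \<Rightarrow> 'a)"

definition coalgebra ::
    "('k, 'r) ring_scheme \<Rightarrow> 'k \<Rightarrow> ('k, 'a) module \<Rightarrow> ('a \<Rightarrow> nat \<Rightarrow> 'a) \<Rightarrow> bool" where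
  "coalgebra K lam A f \<longleftrightarrow> algebra K A \<and> f \<in> alg_hom K A (hurwitz_alg K lam A) \<and>
     compose (carrier A) (eps K lam A) f = (\<lambda>x\<in>carrier A. x) \<and>
     compose (carrier A) (delta K lam A) f
       = compose (carrier A) (hurwitz_map K lam A f) f"

definition coalg_hom ::
    "('k, 'r) ring_scheme \<Rightarrow> 'k \<Rightarrow> ('k, 'a) coalg \<Rightarrow> ('k, 'b) coalg \<Rightarrow> ('a \<Rightarrow> 'b) set" where
  "coalg_hom K lam X Y = {\<phi> \<in> alg_hom K (fst X) (fst Y).
     compose (carrier (fst X)) (snd Y) \<phi>
       = compose (carrier (fst X)) (hurwitz_map K lam (fst X) \<phi>) (snd X)}"

definition ALG_C :: "('k, 'r) ring_scheme \<Rightarrow> 'k \<Rightarrow> (('k, 'a) coalg, 'a \<Rightarrow> 'a) cat" where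
  "ALG_C K lam = \<lparr> Obj = {(A, f). coalgebra K lam A f},
     Hom = coalg_hom K lam,
     Idt = (\<lambda>X. \<lambda>x\<in>carrier (fst X). x),
     Cmp = (\<lambda>X Y Z g f. compose (carrier (fst X)) g f) \<rparr>"

definition H_ftr :: "(('k, 'a) dalg, 'a \<Rightarrow> 'a, ('k, 'a) coalg, 'a \<Rightarrow> 'a) ftr" where
  "H_ftr = \<lparr> fobj = (\<lambda>X. (fst X, eta X)), fmap = (\<lambda>X Y \<phi>. \<phi>) \<rparr>"

text \<open>Comonadic: the forgetful functor is a left adjoint and the cocomparison is an isomorphism.\<close>

definition DIF_comonadic_over_ALG :: "('k, 'r) ring_scheme \<Rightarrow> 'k \<Rightarrow> 'a itself \<Rightarrow> bool" where
  "DIF_comonadic_over_ALG K lam (T :: 'a itself) \<longleftrightarrow> V_adjoint_G K lam T \<and>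
     isomorphism_of_categories (DIF K lam :: (('k, 'a) dalg, 'a \<Rightarrow> 'a) cat) (ALG_C K lam) H_ftr"

end

theory Submission
  imports Defs
begin

text \<open>
  A coalgebra structure \<open>f : A \<rightarrow> A\<^sup>\<nat>\<close> is determined by the single map \<open>d x = f x 1\<close>: the counit law
  says \<open>f x 0 = x\<close> and coassociativity says \<open>f x (m + n) = f (f x m) n\<close>, so \<open>f x n\<close> is the \<open>n\<close>-fold
  iterate of \<open>d\<close> at \<open>x\<close> (\<open>coalgebra_is_iteration\<close>). Evaluating the Hurwitz product at \<open>1\<close> gives the
  \<open>\<lambda>\<close>-Leibniz rule, so \<open>d\<close> is a \<open>\<lambda>\<close>-derivation because \<open>f\<close> is multiplicative
  (\<open>lambda_derivation_of_coalgebra\<close>). Conversely, the iterates of any \<open>\<lambda>\<close>-derivation form a coalgebra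
  (\<open>coalgebra_eta\<close>). The two passages are mutually inverse, and a homomorphism commutes with two
  derivations iff it commutes with all their iterates (\<open>dif_hom_eq_coalg_hom\<close>). Hence the
  cocomparison functor is bijective on objects and on each hom-set.

  What carries the computations is one property of the Hurwitz product (\<open>hurwitz_mult_Suc\<close>):
  the shift \<open>\<partial>\<close> satisfies
  \<open>\<partial>(f g) = \<partial>f g + f \<partial>g + \<lambda> \<partial>f \<partial>g\<close>. It is Pascal's rule for trinomial coefficients.
  Together with \<open>(f g) 0 = f 0 g 0\<close> it determines the product recursively, so that every
  identity about products (commutativity, associativity, distributivity, the unit law, compatibility
  with \<open>h\<^sup>\<nat>\<close>, multiplicativity of \<open>x \<mapsto> (d\<^sup>n x)\<^sub>n\<close>) becomes an induction on the index \<open>n\<close>, with the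
  sequences generalised, and needs no further manipulation of double sums.
\<close>

section \<open>Trinomial coefficients\<close>

definition trinomial :: "nat \<Rightarrow> nat \<Rightarrow> nat \<Rightarrow> nat" where
  "trinomial n k j = (n choose k) * ((n - k) choose j)"

lemma trinomial_eq_0: "n < k + j \<Longrightarrow> trinomial n k j = 0"
  by (cases "n < k") (auto simp: trinomial_def binomial_eq_0)

text \<open>
  This is Pascal's rule: the coefficient counts the words of length \<open>n\<close> with \<open>k\<close> letters of one kind
  and \<open>j\<close> of a second, and the three summands sort the words of length \<open>n + 1\<close> by
  their last letter. In the Leibniz rule below the letters say which of \<open>f\<close>, \<open>g\<close> or both is
  differentiated.
\<close>

lemma trinomial_Suc:
  "trinomial (Suc n) k j = trinomial n k j
     + (case j of 0 \<Rightarrow> 0 | Suc j' \<Rightarrow> trinomial n k j')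
     + (case k of 0 \<Rightarrow> 0 | Suc k' \<Rightarrow> trinomial n k' j)"
proof -
  have drop: "(n choose k) * ((Suc n - k) choose j)
      = trinomial n k j + (case j of 0 \<Rightarrow> 0 | Suc j' \<Rightarrow> trinomial n k j')" for k
  proof (cases "k \<le> n")
    case True
    then show ?thesis
      by (cases j) (simp_all add: trinomial_def Suc_diff_le distrib_left)
  next
    case False
    then show ?thesis
      by (simp add: trinomial_def binomial_eq_0 split: nat.split)
  qed
  show ?thesis
  proof (cases k)
    case 0
    show ?thesis
      using drop[of 0] unfolding 0 by (simp add: trinomial_def)
  next
    case (Suc k')
    have "trinomial (Suc n) k j
        = (n choose k') * ((n - k') choose j) + (n choose k) * ((Suc n - k) choose j)"
      by (simp add: Suc trinomial_def distrib_right)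
    then show ?thesis
      unfolding drop by (simp add: Suc trinomial_def)
  qed
qed

section \<open>The Leibniz rule for the Hurwitz product\<close>

locale weighted_algebra = algebra K A for K :: "('k, 'r) ring_scheme" and A :: "('k, 'a) module" +
  fixes lam :: 'k
  assumes lam_closed [simp]: "lam \<in> carrier K"
begin

abbreviation hmult (infixl "\<star>" 70) where
  "f \<star> g \<equiv> hurwitz_mult K lam A f g"

abbreviation seqs where
  "seqs \<equiv> carrier (hurwitz_alg K lam A)"

lemma mem_seqs [simp]: "f \<in> seqs \<longleftrightarrow> (\<forall>n. f n \<in> carrier A)"
  by (simp add: hurwitz_alg_def)

lemma smult_add_pow:
  assumes "c \<in> carrier K" "x \<in> carrier A"
  shows "c \<odot>\<^bsub>A\<^esub> add_pow A (m::nat) x = add_pow A m (c \<odot>\<^bsub>A\<^esub> x)"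
  using assms by (induction m) (simp_all add: smult_r_distr)

definition hurwitz_term ::
    "nat \<Rightarrow> (nat \<Rightarrow> 'a) \<Rightarrow> (nat \<Rightarrow> 'a) \<Rightarrow> nat \<Rightarrow> nat \<Rightarrow> 'a" where
  "hurwitz_term n f g k j =
     add_pow A (trinomial n k j) ((lam [^]\<^bsub>K\<^esub> k) \<odot>\<^bsub>A\<^esub> (f (n - j) \<otimes>\<^bsub>A\<^esub> g (k + j)))"

lemma hurwitz_term_closed [simp]:
  "f \<in> seqs \<Longrightarrow> g \<in> seqs \<Longrightarrow> hurwitz_term n f g k j \<in> carrier A"
  by (simp add: hurwitz_term_def)

text \<open>
  As the coefficient vanishes outside the triangle \<open>k + j \<le> n\<close>, the double sum may range over any
  rectangle that contains it. This lets the sums on the two sides of the Leibniz rule, whose triangles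
  are shifted against each other, be compared summand by summand.
\<close>

lemma hurwitz_mult_box:
  assumes f: "f \<in> seqs" and g: "g \<in> seqs" and le: "n \<le> N" "n \<le> M"
  shows "(f \<star> g) n = (\<Oplus>\<^bsub>A\<^esub>k\<in>{..N}. \<Oplus>\<^bsub>A\<^esub>j\<in>{..M}. hurwitz_term n f g k j)"
proof -
  have inner: "(\<Oplus>\<^bsub>A\<^esub>j\<in>{0..n - k}. hurwitz_term n f g k j)
      = (\<Oplus>\<^bsub>A\<^esub>j\<in>{..M}. hurwitz_term n f g k j)" for k
    using f g le
    by (intro M.add.finprod_mono_neutral_cong_left)
       (auto simp: Pi_def hurwitz_term_def trinomial_eq_0)
  have "(f \<star> g) n = (\<Oplus>\<^bsub>A\<^esub>k\<in>{0..n}. \<Oplus>\<^bsub>A\<^esub>j\<in>{0..n - k}. hurwitz_term n f g k j)"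
    by (simp add: hurwitz_mult_def hurwitz_term_def trinomial_def)
  also have "\<dots> = (\<Oplus>\<^bsub>A\<^esub>k\<in>{0..n}. \<Oplus>\<^bsub>A\<^esub>j\<in>{..M}. hurwitz_term n f g k j)"
    by (simp only: inner)
  also have "\<dots> = (\<Oplus>\<^bsub>A\<^esub>k\<in>{..N}. \<Oplus>\<^bsub>A\<^esub>j\<in>{..M}. hurwitz_term n f g k j)"
  proof (intro M.add.finprod_mono_neutral_cong_left)
    fix k assume "k \<in> {..N} - {0..n}"
    then show "(\<Oplus>\<^bsub>A\<^esub>j\<in>{..M}. hurwitz_term n f g k j) = \<zero>\<^bsub>A\<^esub>"
      using f g by (intro M.add.finprod_one_eqI) (auto simp: hurwitz_term_def trinomial_eq_0)
  qed (use f g le in \<open>auto simp: Pi_def\<close>)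
  finally show ?thesis .
qed

lemma hurwitz_mult_closed [simp]:
  "f \<in> seqs \<Longrightarrow> g \<in> seqs \<Longrightarrow> (f \<star> g) n \<in> carrier A"
  by (subst hurwitz_mult_box[of f g n n n]) (auto simp: Pi_def)

lemma hurwitz_mult_0: "f \<in> seqs \<Longrightarrow> g \<in> seqs \<Longrightarrow> (f \<star> g) 0 = f 0 \<otimes>\<^bsub>A\<^esub> g 0"
  by (subst hurwitz_mult_box[of f g 0 0 0])
     (auto simp: Pi_def hurwitz_term_def trinomial_def)

text \<open>
  The three parts of Pascal's rule become the three terms of the Leibniz rule. The truncated
  subtraction in the index of \<open>f\<close> is harmless: it only cuts off where the coefficient is zero.
\<close>

lemma hurwitz_term_Suc:
  assumes f: "f \<in> seqs" and g: "g \<in> seqs"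
  shows "hurwitz_term (Suc n) f g k j =
     hurwitz_term n (\<lambda>m. f (Suc m)) g k j
     \<oplus>\<^bsub>A\<^esub> (case j of 0 \<Rightarrow> \<zero>\<^bsub>A\<^esub> | Suc j' \<Rightarrow> hurwitz_term n f (\<lambda>m. g (Suc m)) k j')
     \<oplus>\<^bsub>A\<^esub> (case k of 0 \<Rightarrow> \<zero>\<^bsub>A\<^esub>
           | Suc k' \<Rightarrow> lam \<odot>\<^bsub>A\<^esub> hurwitz_term n (\<lambda>m. f (Suc m)) (\<lambda>m. g (Suc m)) k' j)"
proof -
  \<comment> \<open>All four summands are multiples of the same element.\<close>
  define x where "x = (lam [^]\<^bsub>K\<^esub> k) \<odot>\<^bsub>A\<^esub> (f (Suc n - j) \<otimes>\<^bsub>A\<^esub> g (k + j))"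
  have x: "x \<in> carrier A" using f g by (simp add: x_def)
  have 1: "hurwitz_term n (\<lambda>m. f (Suc m)) g k j = add_pow A (trinomial n k j) x"
    by (cases "n < k + j") (simp_all add: hurwitz_term_def trinomial_eq_0 x_def Suc_diff_le)
  have 2: "(case j of 0 \<Rightarrow> \<zero>\<^bsub>A\<^esub> | Suc j' \<Rightarrow> hurwitz_term n f (\<lambda>m. g (Suc m)) k j')
      = add_pow A (case j of 0 \<Rightarrow> 0 | Suc j' \<Rightarrow> trinomial n k j') x"
    by (cases j) (simp_all add: hurwitz_term_def x_def)
  have 3: "(case k of 0 \<Rightarrow> \<zero>\<^bsub>A\<^esub>
        | Suc k' \<Rightarrow> lam \<odot>\<^bsub>A\<^esub> hurwitz_term n (\<lambda>m. f (Suc m)) (\<lambda>m. g (Suc m)) k' j)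
      = add_pow A (case k of 0 \<Rightarrow> 0 | Suc k' \<Rightarrow> trinomial n k' j) x"
  proof (cases k)
    case 0
    then show ?thesis by simp
  next
    case (Suc k')
    have "lam [^]\<^bsub>K\<^esub> Suc k' = lam \<otimes>\<^bsub>K\<^esub> lam [^]\<^bsub>K\<^esub> k'"
      by (simp add: R.m_comm)
    then show ?thesis
      using f g
      by (cases "n < k' + j")
         (simp_all add: hurwitz_term_def trinomial_eq_0 x_def Suc smult_add_pow smult_assoc1
            Suc_diff_le)
  qed
  have "hurwitz_term (Suc n) f g k j = add_pow A (trinomial (Suc n) k j) x"
    by (simp add: hurwitz_term_def x_def)
  then show ?thesis
    using x by (simp add: trinomial_Suc 1 2 3 flip: M.add.nat_pow_mult)
qed

text \<open>
  The recursion from which all laws of the product follow. Read as an identity of functions of \<open>n\<close>, it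
  says that the shift is a \<open>\<lambda>\<close>-derivation.
\<close>

lemma hurwitz_mult_Suc:
  assumes f: "f \<in> seqs" and g: "g \<in> seqs"
  shows "(f \<star> g) (Suc n) = ((\<lambda>m. f (Suc m)) \<star> g) n \<oplus>\<^bsub>A\<^esub> (f \<star> (\<lambda>m. g (Suc m))) n
     \<oplus>\<^bsub>A\<^esub> lam \<odot>\<^bsub>A\<^esub> ((\<lambda>m. f (Suc m)) \<star> (\<lambda>m. g (Suc m))) n"
proof -
  let ?f = "\<lambda>m. f (Suc m)" and ?g = "\<lambda>m. g (Suc m)"
  define a where "a k j = hurwitz_term n ?f g k j" for k j
  define b where "b k j = (case j of 0 \<Rightarrow> \<zero>\<^bsub>A\<^esub> | Suc j' \<Rightarrow> hurwitz_term n f ?g k j')" for k j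
  define c where
    "c k j = (case k of 0 \<Rightarrow> \<zero>\<^bsub>A\<^esub> | Suc k' \<Rightarrow> lam \<odot>\<^bsub>A\<^esub> hurwitz_term n ?f ?g k' j)" for k j
  have [simp]: "a k j \<in> carrier A" "b k j \<in> carrier A" "c k j \<in> carrier A" for k j
    using f g by (simp_all add: a_def b_def c_def split: nat.split)
  have "(f \<star> g) (Suc n)
      = (\<Oplus>\<^bsub>A\<^esub>k\<in>{..Suc n}. \<Oplus>\<^bsub>A\<^esub>j\<in>{..Suc n}. a k j \<oplus>\<^bsub>A\<^esub> b k j \<oplus>\<^bsub>A\<^esub> c k j)"
    by (simp only: hurwitz_mult_box[OF f g le_refl le_refl] hurwitz_term_Suc[OF f g]
        a_def b_def c_def)
  also have "\<dots> = (\<Oplus>\<^bsub>A\<^esub>k\<in>{..Suc n}. \<Oplus>\<^bsub>A\<^esub>j\<in>{..Suc n}. a k j)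
      \<oplus>\<^bsub>A\<^esub> (\<Oplus>\<^bsub>A\<^esub>k\<in>{..Suc n}. \<Oplus>\<^bsub>A\<^esub>j\<in>{..Suc n}. b k j)
      \<oplus>\<^bsub>A\<^esub> (\<Oplus>\<^bsub>A\<^esub>k\<in>{..Suc n}. \<Oplus>\<^bsub>A\<^esub>j\<in>{..Suc n}. c k j)"
    by (simp add: Pi_def M.finsum_addf del: M.add.finprod_Suc)
  also have "(\<Oplus>\<^bsub>A\<^esub>k\<in>{..Suc n}. \<Oplus>\<^bsub>A\<^esub>j\<in>{..Suc n}. a k j) = (?f \<star> g) n"
    using f g by (simp only: a_def) (rule hurwitz_mult_box[symmetric]; simp)
  also have "(\<Oplus>\<^bsub>A\<^esub>k\<in>{..Suc n}. \<Oplus>\<^bsub>A\<^esub>j\<in>{..Suc n}. b k j) = (f \<star> ?g) n"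
  proof -
    have "(\<Oplus>\<^bsub>A\<^esub>j\<in>{..Suc n}. b k j) = (\<Oplus>\<^bsub>A\<^esub>j\<in>{..n}. hurwitz_term n f ?g k j)" for k
      by (subst M.finsum_Suc2) (use f g in \<open>simp_all add: Pi_def, simp add: b_def Pi_def\<close>)
    then show ?thesis
      using f g by (simp only:) (rule hurwitz_mult_box[symmetric]; simp)
  qed
  also have "(\<Oplus>\<^bsub>A\<^esub>k\<in>{..Suc n}. \<Oplus>\<^bsub>A\<^esub>j\<in>{..Suc n}. c k j) = lam \<odot>\<^bsub>A\<^esub> (?f \<star> ?g) n"
  proof -
    have "(\<Oplus>\<^bsub>A\<^esub>k\<in>{..Suc n}. \<Oplus>\<^bsub>A\<^esub>j\<in>{..Suc n}. c k j)
        = (\<Oplus>\<^bsub>A\<^esub>k\<in>{..n}. \<Oplus>\<^bsub>A\<^esub>j\<in>{..Suc n}. c (Suc k) j) \<oplus>\<^bsub>A\<^esub> (\<Oplus>\<^bsub>A\<^esub>j\<in>{..Suc n}. c 0 j)"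
      by (rule M.finsum_Suc2) (simp add: Pi_def del: M.add.finprod_Suc)
    also have "\<dots>
        = (\<Oplus>\<^bsub>A\<^esub>k\<in>{..n}. \<Oplus>\<^bsub>A\<^esub>j\<in>{..Suc n}. lam \<odot>\<^bsub>A\<^esub> hurwitz_term n ?f ?g k j)"
      using f g by (simp add: Pi_def c_def del: M.add.finprod_Suc)
    also have "\<dots> = lam \<odot>\<^bsub>A\<^esub> (\<Oplus>\<^bsub>A\<^esub>k\<in>{..n}. \<Oplus>\<^bsub>A\<^esub>j\<in>{..Suc n}. hurwitz_term n ?f ?g k j)"
      using f g
      by (simp add: Pi_def finsum_smult_ldistr del: M.add.finprod_Suc)
    also have "\<dots> = lam \<odot>\<^bsub>A\<^esub> (?f \<star> ?g) n"
      using f g by (subst hurwitz_mult_box[of ?f ?g n n "Suc n"]) simp_all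
    finally show ?thesis .
  qed
  finally show ?thesis .
qed


section \<open>The Hurwitz algebra\<close>

text \<open>
  In this and the following inductions the sequences must be arbitrary, since the induction hypothesis
  is applied to their shifts. Commutativity comes first, so that additivity and
  homogeneity in the second argument follow from those in the first.
\<close>

lemma hurwitz_mult_comm:
  assumes "f \<in> seqs" "g \<in> seqs"
  shows "f \<star> g = g \<star> f"
proof
  fix n show "(f \<star> g) n = (g \<star> f) n"
    using assms
  proof (induction n arbitrary: f g)
    case 0
    then show ?case by (simp add: hurwitz_mult_0 m_comm)
  next
    case (Suc n)
    from Suc.prems show ?case
      by (simp add: hurwitz_mult_Suc Suc.IH[of f] Suc.IH[of "\<lambda>m. f (Suc m)"] M.a_ac)
  qed
qed

lemma hurwitz_mult_add_left:
  assumes "f \<in> seqs" "f' \<in> seqs" "g \<in> seqs"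
  shows "(\<lambda>n. f n \<oplus>\<^bsub>A\<^esub> f' n) \<star> g = (\<lambda>n. (f \<star> g) n \<oplus>\<^bsub>A\<^esub> (f' \<star> g) n)"
proof
  fix n show "((\<lambda>n. f n \<oplus>\<^bsub>A\<^esub> f' n) \<star> g) n = (f \<star> g) n \<oplus>\<^bsub>A\<^esub> (f' \<star> g) n"
    using assms
  proof (induction n arbitrary: f f' g)
    case 0
    then show ?case by (simp add: hurwitz_mult_0 l_distr)
  next
    case (Suc n)
    from Suc.prems show ?case
      by (simp add: hurwitz_mult_Suc Suc.IH smult_r_distr M.a_ac)
  qed
qed

lemma hurwitz_mult_smult_left:
  assumes "c \<in> carrier K" "f \<in> seqs" "g \<in> seqs"
  shows "(\<lambda>n. c \<odot>\<^bsub>A\<^esub> f n) \<star> g = (\<lambda>n. c \<odot>\<^bsub>A\<^esub> (f \<star> g) n)"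
proof
  fix n show "((\<lambda>n. c \<odot>\<^bsub>A\<^esub> f n) \<star> g) n = c \<odot>\<^bsub>A\<^esub> (f \<star> g) n"
    using assms
  proof (induction n arbitrary: f g)
    case 0
    then show ?case by (simp add: hurwitz_mult_0 smult_assoc2)
  next
    case (Suc n)
    from Suc.prems show ?case
      by (simp add: hurwitz_mult_Suc Suc.IH smult_r_distr R.m_comm flip: smult_assoc1)
  qed
qed

lemma hurwitz_mult_add_right:
  assumes "f \<in> seqs" "g \<in> seqs" "g' \<in> seqs"
  shows "f \<star> (\<lambda>n. g n \<oplus>\<^bsub>A\<^esub> g' n) = (\<lambda>n. (f \<star> g) n \<oplus>\<^bsub>A\<^esub> (f \<star> g') n)"
  using assms hurwitz_mult_add_left[of g g' f]
  by (simp add: hurwitz_mult_comm[of f])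

lemma hurwitz_mult_smult_right:
  assumes "c \<in> carrier K" "f \<in> seqs" "g \<in> seqs"
  shows "f \<star> (\<lambda>n. c \<odot>\<^bsub>A\<^esub> g n) = (\<lambda>n. c \<odot>\<^bsub>A\<^esub> (f \<star> g) n)"
  using assms hurwitz_mult_smult_left[of c g f]
  by (simp add: hurwitz_mult_comm[of f])

text \<open>
  Applying the recursion twice to either side produces the same seven products of shifts of
  \<open>f\<close>, \<open>g\<close> and \<open>h\<close>, one for each nonempty subset of the factors, and the induction hypothesis
  matches them.
\<close>

lemma hurwitz_mult_assoc:
  assumes "f \<in> seqs" "g \<in> seqs" "h \<in> seqs"
  shows "(f \<star> g) \<star> h = f \<star> (g \<star> h)"
proof
  fix n show "((f \<star> g) \<star> h) n = (f \<star> (g \<star> h)) n"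
    using assms
  proof (induction n arbitrary: f g h)
    case 0
    then show ?case by (simp add: hurwitz_mult_0 m_assoc)
  next
    case (Suc n)
    from Suc.prems show ?case
      by (simp add: hurwitz_mult_Suc hurwitz_mult_add_left hurwitz_mult_add_right
          hurwitz_mult_smult_left hurwitz_mult_smult_right Suc.IH smult_r_distr M.a_ac)
  qed
qed

lemma hurwitz_mult_zero_left:
  assumes "g \<in> seqs"
  shows "(\<lambda>n. \<zero>\<^bsub>A\<^esub>) \<star> g = (\<lambda>n. \<zero>\<^bsub>A\<^esub>)"
  \<comment> \<open>The zero sequence is the scalar \<open>0\<close> times itself.\<close>
  using assms hurwitz_mult_smult_left[of "\<zero>\<^bsub>K\<^esub>" "\<lambda>n. \<zero>\<^bsub>A\<^esub>" g] by simp

lemma hurwitz_mult_one_left: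
  assumes "g \<in> seqs"
  shows "(\<lambda>n. if n = 0 then \<one>\<^bsub>A\<^esub> else \<zero>\<^bsub>A\<^esub>) \<star> g = g"
proof
  fix n show "((\<lambda>n. if n = 0 then \<one>\<^bsub>A\<^esub> else \<zero>\<^bsub>A\<^esub>) \<star> g) n = g n"
    using assms
  proof (induction n arbitrary: g)
    case 0
    then show ?case by (simp add: hurwitz_mult_0)
  next
    case (Suc n)
    from Suc.prems show ?case
      by (simp add: hurwitz_mult_Suc Suc.IH hurwitz_mult_zero_left)
  qed
qed

lemma hurwitz_simps [simp]:
  "mult (hurwitz_alg K lam A) = hurwitz_mult K lam A"
  "one (hurwitz_alg K lam A) = (\<lambda>n. if n = 0 then \<one>\<^bsub>A\<^esub> else \<zero>\<^bsub>A\<^esub>)"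
  "zero (hurwitz_alg K lam A) = (\<lambda>n. \<zero>\<^bsub>A\<^esub>)"
  "add (hurwitz_alg K lam A) = (\<lambda>f g n. f n \<oplus>\<^bsub>A\<^esub> g n)"
  "smult (hurwitz_alg K lam A) = (\<lambda>c f n. c \<odot>\<^bsub>A\<^esub> f n)"
  by (simp_all add: hurwitz_alg_def)

theorem algebra_hurwitz: "algebra K (hurwitz_alg K lam A)"
proof (rule algebraI)
  show "cring (hurwitz_alg K lam A)"
  proof (rule cringI)
    show "abelian_group (hurwitz_alg K lam A)"
    proof (rule abelian_groupI)
      fix f assume "f \<in> seqs"
      then have "(\<lambda>n. \<ominus>\<^bsub>A\<^esub> f n) \<in> seqs" "(\<lambda>n. \<ominus>\<^bsub>A\<^esub> f n \<oplus>\<^bsub>A\<^esub> f n) = (\<lambda>n. \<zero>\<^bsub>A\<^esub>)"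
        by (simp_all add: M.l_neg)
      then show "\<exists>g\<in>seqs. g \<oplus>\<^bsub>hurwitz_alg K lam A\<^esub> f = \<zero>\<^bsub>hurwitz_alg K lam A\<^esub>"
        unfolding hurwitz_simps by (intro bexI)
    qed (simp_all add: M.a_ac)
    show "comm_monoid (hurwitz_alg K lam A)"
      by (rule comm_monoidI)
         (simp_all add: hurwitz_mult_assoc hurwitz_mult_one_left, simp add: hurwitz_mult_comm)
  qed (simp add: hurwitz_mult_add_left)
qed (simp_all add: R_cring smult_l_distr smult_r_distr smult_assoc1 hurwitz_mult_smult_left)

lemma shift_der_apply [simp]: "f \<in> seqs \<Longrightarrow> shift_der K lam A f = (\<lambda>n. f (Suc n))"
  by (simp add: shift_der_def)

theorem lambda_derivation_shift: "lambda_derivation K lam (hurwitz_alg K lam A) (shift_der K lam A)"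
  unfolding lambda_derivation_def
proof (intro conjI ballI)
  show "shift_der K lam A \<in> seqs \<rightarrow>\<^sub>E seqs"
    by (auto simp: shift_der_def)
qed (simp_all add: hurwitz_mult_Suc)

lemma shift_der_funpow:
  "f \<in> seqs \<Longrightarrow> (shift_der K lam A ^^ m) f = (\<lambda>n. f (m + n))"
  by (induction m) simp_all

end


section \<open>The categories of algebras and of differential algebras\<close>

lemma compose_eq_compose_iff:
  "compose S g f = compose S g' f' \<longleftrightarrow> (\<forall>x\<in>S. g (f x) = g' (f' x))"
  by (auto simp: compose_def fun_eq_iff restrict_def)

lemma compose_eq_restrict_iff:
  "compose S g f = restrict h S \<longleftrightarrow> (\<forall>x\<in>S. g (f x) = h x)"
  by (auto simp: compose_def fun_eq_iff restrict_def)

text \<open>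
  The categories of algebras, of differential algebras and of coalgebras all consist of extensional maps
  with the usual composition, so the category laws reduce to closure of the hom-sets under identities
  and composition.
\<close>

lemma category_of_extensional_maps:
  fixes \<C> :: "('o, 'a \<Rightarrow> 'a) cat" and car :: "'o \<Rightarrow> 'a set"
  assumes Idt: "\<And>X. Idt \<C> X = (\<lambda>x\<in>car X. x)"
    and Cmp: "\<And>X Y Z g f. Cmp \<C> X Y Z g f = compose (car X) g f"
    and Hom: "\<And>X Y f. f \<in> Hom \<C> X Y \<Longrightarrow> f \<in> car X \<rightarrow>\<^sub>E car Y"
    and Idt_Hom: "\<And>X. X \<in> Obj \<C> \<Longrightarrow> (\<lambda>x\<in>car X. x) \<in> Hom \<C> X X"
    and Cmp_Hom: "\<And>X Y Z f g. \<lbrakk>X \<in> Obj \<C>; Y \<in> Obj \<C>; Z \<in> Obj \<C>; f \<in> Hom \<C> X Y; g \<in> Hom \<C> Y Z\<rbrakk>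
      \<Longrightarrow> compose (car X) g f \<in> Hom \<C> X Z"
  shows "category \<C>"
  unfolding category_def Idt Cmp
proof (intro conjI ballI)
  fix X Y f assume "f \<in> Hom \<C> X Y"
  from Hom[OF this] have f: "f \<in> car X \<rightarrow> car Y" "f \<in> extensional (car X)"
    by (auto simp: PiE_def)
  then show "compose (car X) f (\<lambda>x\<in>car X. x) = f" "compose (car X) (\<lambda>x\<in>car Y. x) f = f"
    by (simp_all add: compose_Id Id_compose)
next
  fix W X Y Z f g h assume "f \<in> Hom \<C> W X"
  from Hom[OF this] have "f \<in> car W \<rightarrow> car X"
    by (simp add: PiE_def)
  then show "compose (car W) h (compose (car W) g f) = compose (car W) (compose (car X) h g) f"
    by (rule compose_assoc)
qed (auto intro: Idt_Hom Cmp_Hom)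

lemma alg_hom_iff:
  "h \<in> alg_hom K A B \<longleftrightarrow> h \<in> carrier A \<rightarrow>\<^sub>E carrier B
     \<and> (\<forall>x\<in>carrier A. \<forall>y\<in>carrier A. h (x \<otimes>\<^bsub>A\<^esub> y) = h x \<otimes>\<^bsub>B\<^esub> h y)
     \<and> (\<forall>x\<in>carrier A. \<forall>y\<in>carrier A. h (x \<oplus>\<^bsub>A\<^esub> y) = h x \<oplus>\<^bsub>B\<^esub> h y)
     \<and> h \<one>\<^bsub>A\<^esub> = \<one>\<^bsub>B\<^esub>
     \<and> (\<forall>c\<in>carrier K. \<forall>x\<in>carrier A. h (c \<odot>\<^bsub>A\<^esub> x) = c \<odot>\<^bsub>B\<^esub> h x)"
  by (auto simp: alg_hom_def ring_hom_def)

lemma alg_hom_closed: "h \<in> alg_hom K A B \<Longrightarrow> x \<in> carrier A \<Longrightarrow> h x \<in> carrier B"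
  by (auto simp: alg_hom_iff)

lemma alg_hom_zero:
  assumes A: "algebra K A" and B: "algebra K B" and h: "h \<in> alg_hom K A B"
  shows "h \<zero>\<^bsub>A\<^esub> = \<zero>\<^bsub>B\<^esub>"
proof -
  interpret A: algebra K A by (rule A)
  interpret B: algebra K B by (rule B)
  have "h (c \<odot>\<^bsub>A\<^esub> x) = c \<odot>\<^bsub>B\<^esub> h x" if "c \<in> carrier K" "x \<in> carrier A" for c x
    using h that by (simp add: alg_hom_iff)
  from this[of "\<zero>\<^bsub>K\<^esub>" "\<zero>\<^bsub>A\<^esub>"] show ?thesis
    using h by (simp add: alg_hom_closed)
qed

lemma restrict_id_alg_hom:
  assumes "algebra K A"
  shows "(\<lambda>x\<in>carrier A. x) \<in> alg_hom K A A"
proof -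
  interpret algebra K A by (rule assms)
  show ?thesis by (simp add: alg_hom_iff)
qed

lemma compose_alg_hom:
  assumes "algebra K A" and f: "f \<in> alg_hom K A B" and g: "g \<in> alg_hom K B C"
  shows "compose (carrier A) g f \<in> alg_hom K A C"
proof -
  interpret algebra K A by (rule assms)
  have "f x \<in> carrier B" if "x \<in> carrier A" for x
    using f that by (rule alg_hom_closed)
  moreover have "g y \<in> carrier C" if "y \<in> carrier B" for y
    using g that by (rule alg_hom_closed)
  ultimately show ?thesis
    using f g by (simp add: alg_hom_iff compose_eq) (simp add: PiE_def compose_def)
qed

lemma dif_hom_iff:
  "f \<in> dif_hom K X Y \<longleftrightarrow> f \<in> alg_hom K (fst X) (fst Y)
     \<and> (\<forall>x\<in>carrier (fst X). f (snd X x) = snd Y (f x))"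
  by (simp add: dif_hom_def compose_eq_compose_iff)

lemma dif_hom_iterate:
  assumes "f \<in> dif_hom K X Y" and "\<And>x. x \<in> carrier (fst X) \<Longrightarrow> snd X x \<in> carrier (fst X)"
    and "x \<in> carrier (fst X)"
  shows "f ((snd X ^^ n) x) = (snd Y ^^ n) (f x)"
proof -
  have "(snd X ^^ n) x \<in> carrier (fst X) \<and> f ((snd X ^^ n) x) = (snd Y ^^ n) (f x)"
    using assms by (induction n) (simp_all add: dif_hom_iff)
  then show ?thesis ..
qed

lemma lambda_derivation_closed:
  "lambda_derivation K lam R d \<Longrightarrow> x \<in> carrier R \<Longrightarrow> d x \<in> carrier R"
  by (auto simp: lambda_derivation_def)

lemma category_ALG: "category (ALG K)"
  by (rule category_of_extensional_maps[where car = carrier])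
     (auto simp: ALG_def intro: restrict_id_alg_hom compose_alg_hom, auto simp: alg_hom_def)

lemma category_DIF:
  fixes K :: "('k, 'r) ring_scheme" and lam :: 'k
  shows "category (DIF K lam :: (('k, 'a) dalg, 'a \<Rightarrow> 'a) cat)"
proof (rule category_of_extensional_maps[where car = "\<lambda>X. carrier (fst X)"])
  fix X :: "('k, 'a) dalg" assume "X \<in> Obj (DIF K lam)"
  then show "(\<lambda>x\<in>carrier (fst X). x) \<in> Hom (DIF K lam) X X"
    by (auto simp: DIF_def dif_hom_iff restrict_id_alg_hom lambda_derivation_closed)
next
  fix X Y Z :: "('k, 'a) dalg" and f g
  assume obj: "X \<in> Obj (DIF K lam)" "Y \<in> Obj (DIF K lam)" "Z \<in> Obj (DIF K lam)"
    and f: "f \<in> Hom (DIF K lam) X Y" and g: "g \<in> Hom (DIF K lam) Y Z"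
  then show "compose (carrier (fst X)) g f \<in> Hom (DIF K lam) X Z"
    by (auto simp: DIF_def dif_hom_iff compose_eq lambda_derivation_closed alg_hom_closed
        intro: compose_alg_hom)
qed (auto simp: DIF_def dif_hom_def alg_hom_def)

lemma weighted_algebraI: "algebra K A \<Longrightarrow> lam \<in> carrier K \<Longrightarrow> weighted_algebra K A lam"
  by (simp add: weighted_algebra_def weighted_algebra_axioms_def)

section \<open>The Hurwitz functor on homomorphisms\<close>

text \<open>
  The recursion for the product has the same shape in \<open>A\<close> and in \<open>B\<close>, and \<open>h\<close> preserves all the
  operations in it, including the action of \<open>\<lambda>\<close>.
\<close>

lemma hurwitz_map_mult:
  assumes A: "algebra K A" and B: "algebra K B" and lam: "lam \<in> carrier K"
    and h: "h \<in> alg_hom K A B"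
    and "\<forall>n. f n \<in> carrier A" "\<forall>n. g n \<in> carrier A"
  shows "h (hurwitz_mult K lam A f g n)
    = hurwitz_mult K lam B (\<lambda>n. h (f n)) (\<lambda>n. h (g n)) n"
proof -
  interpret A: weighted_algebra K A lam using A lam by (rule weighted_algebraI)
  interpret B: weighted_algebra K B lam using B lam by (rule weighted_algebraI)
  note hom = h[unfolded alg_hom_iff]
  show ?thesis
    using assms(5,6)
  proof (induction n arbitrary: f g)
    case 0
    with h hom show ?case
      by (simp add: A.hurwitz_mult_0 B.hurwitz_mult_0 alg_hom_closed)
  next
    case (Suc n)
    with h hom show ?case
      by (simp add: A.hurwitz_mult_Suc B.hurwitz_mult_Suc alg_hom_closed)
  qed
qed

lemma hurwitz_map_dif_hom:
  assumes A: "algebra K A" and B: "algebra K B" and lam: "lam \<in> carrier K"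
    and h: "h \<in> alg_hom K A B"
  shows "hurwitz_map K lam A h
    \<in> dif_hom K (hurwitz_alg K lam A, shift_der K lam A) (hurwitz_alg K lam B, shift_der K lam B)"
proof -
  interpret A: weighted_algebra K A lam using A lam by (rule weighted_algebraI)
  interpret B: weighted_algebra K B lam using B lam by (rule weighted_algebraI)
  note hom = h[unfolded alg_hom_iff]
  have map: "hurwitz_map K lam A h f = (\<lambda>n. h (f n))" if "f \<in> A.seqs" for f
    using that by (simp add: hurwitz_map_def)
  have "hurwitz_map K lam A h \<in> A.seqs \<rightarrow>\<^sub>E B.seqs"
    using h by (auto simp: hurwitz_map_def alg_hom_closed)
  then have "hurwitz_map K lam A h \<in> alg_hom K (hurwitz_alg K lam A) (hurwitz_alg K lam B)"
    unfolding alg_hom_iff[of "hurwitz_map K lam A h"]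
    using h hom by (auto simp: map fun_eq_iff hurwitz_map_mult[OF A B lam h] alg_hom_zero[OF A B h])
  then show ?thesis
    using h by (simp add: dif_hom_iff map alg_hom_closed)
qed

section \<open>Iterates of a derivation\<close>

locale weighted_differential_algebra = weighted_algebra K A lam
  for K :: "('k, 'r) ring_scheme" and A :: "('k, 'a) module" and lam +
  fixes d :: "'a \<Rightarrow> 'a"
  assumes derivation: "lambda_derivation K lam A d"
begin

lemma d_closed [simp]: "x \<in> carrier A \<Longrightarrow> d x \<in> carrier A"
  using derivation by (rule lambda_derivation_closed)

lemma d_add: "x \<in> carrier A \<Longrightarrow> y \<in> carrier A \<Longrightarrow> d (x \<oplus>\<^bsub>A\<^esub> y) = d x \<oplus>\<^bsub>A\<^esub> d y"
  and d_smult: "c \<in> carrier K \<Longrightarrow> x \<in> carrier A \<Longrightarrow> d (c \<odot>\<^bsub>A\<^esub> x) = c \<odot>\<^bsub>A\<^esub> d x"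
  and d_mult: "x \<in> carrier A \<Longrightarrow> y \<in> carrier A \<Longrightarrow> d (x \<otimes>\<^bsub>A\<^esub> y)
     = d x \<otimes>\<^bsub>A\<^esub> y \<oplus>\<^bsub>A\<^esub> x \<otimes>\<^bsub>A\<^esub> d y \<oplus>\<^bsub>A\<^esub> lam \<odot>\<^bsub>A\<^esub> (d x \<otimes>\<^bsub>A\<^esub> d y)"
  and d_one: "d \<one>\<^bsub>A\<^esub> = \<zero>\<^bsub>A\<^esub>"
  using derivation by (simp_all add: lambda_derivation_def)

lemma d_zero: "d \<zero>\<^bsub>A\<^esub> = \<zero>\<^bsub>A\<^esub>"
  using d_smult[of "\<zero>\<^bsub>K\<^esub>" "\<zero>\<^bsub>A\<^esub>"] by simp

lemma iterate_closed [simp]: "x \<in> carrier A \<Longrightarrow> (d ^^ n) x \<in> carrier A"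
  by (induction n) simp_all

lemma iterate_add:
  "x \<in> carrier A \<Longrightarrow> y \<in> carrier A \<Longrightarrow> (d ^^ n) (x \<oplus>\<^bsub>A\<^esub> y) = (d ^^ n) x \<oplus>\<^bsub>A\<^esub> (d ^^ n) y"
  by (induction n) (simp_all add: d_add)

lemma iterate_smult:
  "c \<in> carrier K \<Longrightarrow> x \<in> carrier A \<Longrightarrow> (d ^^ n) (c \<odot>\<^bsub>A\<^esub> x) = c \<odot>\<^bsub>A\<^esub> (d ^^ n) x"
  by (induction n) (simp_all add: d_smult)

lemma iterate_one: "(d ^^ n) \<one>\<^bsub>A\<^esub> = (if n = 0 then \<one>\<^bsub>A\<^esub> else \<zero>\<^bsub>A\<^esub>)"
  by (induction n) (simp_all add: d_one d_zero)

text \<open>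
  The general Leibniz formula for \<open>d\<^sup>n (x y)\<close>. Peeling off the innermost \<open>d\<close> turns \<open>x y\<close> into a sum of three
  products, to which the induction hypothesis applies; the result is the recursion of the Hurwitz product,
  since shifting the sequence of iterates at \<open>x\<close> gives the one at \<open>d x\<close>.
\<close>

lemma iterate_mult:
  "x \<in> carrier A \<Longrightarrow> y \<in> carrier A \<Longrightarrow>
     (d ^^ n) (x \<otimes>\<^bsub>A\<^esub> y) = ((\<lambda>m. (d ^^ m) x) \<star> (\<lambda>m. (d ^^ m) y)) n"
proof (induction n arbitrary: x y)
  case 0
  then show ?case by (simp add: hurwitz_mult_0)
next
  case (Suc n)
  then show ?case
    by (simp add: hurwitz_mult_Suc funpow_Suc_right d_mult iterate_add iterate_smult
        del: funpow.simps)
qed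

lemma eta_apply [simp]: "x \<in> carrier A \<Longrightarrow> eta (A, d) x = (\<lambda>n. (d ^^ n) x)"
  by (simp add: eta_def)

lemma eta_closed: "eta (A, d) \<in> carrier A \<rightarrow>\<^sub>E seqs"
  by (auto simp: eta_def)

lemma eta_dif_hom: "eta (A, d) \<in> dif_hom K (A, d) (hurwitz_alg K lam A, shift_der K lam A)"
  using eta_closed
  by (simp add: dif_hom_iff alg_hom_iff iterate_mult iterate_add iterate_smult iterate_one
      funpow_swap1)

text \<open>
  The counit law is \<open>d\<^sup>0 x = x\<close>, and coassociativity is \<open>d\<^sup>m\<^sup>+\<^sup>n x = d\<^sup>n (d\<^sup>m x)\<close>.
\<close>

lemma coalgebra_eta: "coalgebra K lam A (eta (A, d))"
proof -
  have swap: "(d ^^ n) ((d ^^ m) x) = (d ^^ (m + n)) x" for m n x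
    by (simp add: add.commute[of m] funpow_add)
  have "delta K lam A (eta (A, d) x) = hurwitz_map K lam A (eta (A, d)) (eta (A, d) x)"
    if "x \<in> carrier A" for x
    using that by (simp add: delta_def eta_def[of "(hurwitz_alg K lam A, _)"] hurwitz_map_def
        shift_der_funpow swap)
  moreover have "eps K lam A (eta (A, d) x) = x" if "x \<in> carrier A" for x
    using that by (simp add: eps_def)
  ultimately show ?thesis
    using eta_dif_hom
    by (simp add: coalgebra_def algebra_axioms dif_hom_iff compose_eq_compose_iff
        compose_eq_restrict_iff)
qed

end

section \<open>The adjunction\<close>

lemma weighted_differential_algebraI:
  "X \<in> Obj (DIF K lam) \<Longrightarrow> lam \<in> carrier K
     \<Longrightarrow> weighted_differential_algebra K (fst X) lam (snd X)"
  by (auto simp: DIF_def weighted_differential_algebra_def weighted_differential_algebra_axioms_def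
      weighted_algebraI)

text \<open>
  The unit is a homomorphism by the general Leibniz formula, and natural because a differential
  homomorphism commutes with iterates. The two triangle identities say that \<open>d\<^sup>0 x = x\<close> and that the
  iterated shift recovers a sequence as \<open>f n = (\<partial>\<^sup>n f) 0\<close>.
\<close>

lemma forgetful_adjoint_hurwitz:
  fixes K :: "('k, 'r) ring_scheme" and lam :: 'k
  assumes lam: "lam \<in> carrier K"
  shows "V_adjoint_G K lam TYPE('a)"
proof -
  have wda: "weighted_differential_algebra K (fst X) lam (snd X)"
    if "X \<in> Obj (DIF K lam)" for X :: "('k, 'a) dalg"
    using that lam by (rule weighted_differential_algebraI)
  have wa: "weighted_algebra K A lam"
    if "A \<in> Obj (ALG K)" for A :: "('k, 'a) module"
    using that lam by (auto simp: ALG_def intro: weighted_algebraI)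
  show ?thesis
    unfolding V_adjoint_G_def Let_def
  proof (intro conjI ballI)
    show "is_functor (DIF K lam :: (('k, 'a) dalg, 'a \<Rightarrow> 'a) cat) (ALG K) V_ftr"
      unfolding is_functor_def
      by (simp add: category_DIF category_ALG V_ftr_def) (auto simp: DIF_def ALG_def dif_hom_def)
  next
    show "is_functor (ALG K :: (('k, 'a) module, 'a \<Rightarrow> 'a) cat) (DIF K lam) (G_ftr K lam)"
      unfolding is_functor_def
    proof (intro conjI ballI category_ALG category_DIF)
      fix A :: "('k, 'a) module" assume "A \<in> Obj (ALG K)"
      then interpret weighted_algebra K A lam by (rule wa)
      show "fobj (G_ftr K lam) A \<in> Obj (DIF K lam)"
        by (simp add: G_ftr_def DIF_def algebra_hurwitz lambda_derivation_shift)
      show "fmap (G_ftr K lam) A A (Idt (ALG K) A) = Idt (DIF K lam) (fobj (G_ftr K lam) A)"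
        by (auto simp: G_ftr_def ALG_def DIF_def hurwitz_map_def restrict_def)
    next
      fix A B :: "('k, 'a) module" and h
      assume "A \<in> Obj (ALG K)" "B \<in> Obj (ALG K)" "h \<in> Hom (ALG K) A B"
      then show "fmap (G_ftr K lam) A B h
          \<in> Hom (DIF K lam) (fobj (G_ftr K lam) A) (fobj (G_ftr K lam) B)"
        using lam by (simp add: G_ftr_def DIF_def ALG_def hurwitz_map_dif_hom)
    next
      fix A B C :: "('k, 'a) module" and f g
      assume "A \<in> Obj (ALG K)" "f \<in> Hom (ALG K) A B"
      then show "fmap (G_ftr K lam) A C (Cmp (ALG K) A B C g f)
        = Cmp (DIF K lam) (fobj (G_ftr K lam) A) (fobj (G_ftr K lam) B) (fobj (G_ftr K lam) C)
            (fmap (G_ftr K lam) B C g) (fmap (G_ftr K lam) A B f)"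
        by (auto simp: G_ftr_def DIF_def ALG_def hurwitz_map_def compose_def hurwitz_alg_def
            alg_hom_closed fun_eq_iff)
    qed
  next
    fix X :: "('k, 'a) dalg" assume "X \<in> Obj (DIF K lam)"
    then interpret weighted_differential_algebra K "fst X" lam "snd X" by (rule wda)
    show "eta X \<in> dif_hom K X (fobj (G_ftr K lam) (fst X))"
      using eta_dif_hom by (simp add: G_ftr_def)
    show "compose (carrier (fst X)) (eps K lam (fst X)) (eta X) = (\<lambda>x\<in>carrier (fst X). x)"
      by (simp add: compose_eq_restrict_iff eps_def eta_def)
  next
    fix X Y :: "('k, 'a) dalg" and h
    assume X: "X \<in> Obj (DIF K lam)" and Y: "Y \<in> Obj (DIF K lam)" and h: "h \<in> Hom (DIF K lam) X Y"
    from X interpret weighted_differential_algebra K "fst X" lam "snd X" by (rule wda)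
    have h: "h \<in> dif_hom K X Y" using h by (simp add: DIF_def)
    show "compose (carrier (fst X)) (eta Y) h
        = compose (carrier (fst X)) (hurwitz_map K lam (fst X) h) (eta X)"
      using dif_hom_iterate[OF h d_closed] alg_hom_closed[of h K "fst X" "fst Y"] h
      by (simp add: compose_eq_compose_iff eta_def hurwitz_map_def dif_hom_def)
  next
    fix A :: "('k, 'a) module" assume "A \<in> Obj (ALG K)"
    then interpret weighted_algebra K A lam by (rule wa)
    show "eps K lam A \<in> alg_hom K (fst (fobj (G_ftr K lam) A)) A"
      by (auto simp: G_ftr_def eps_def alg_hom_iff hurwitz_mult_0)
    show "compose (carrier (fst (fobj (G_ftr K lam) A)))
        (hurwitz_map K lam (fst (fobj (G_ftr K lam) A)) (eps K lam A)) (eta (fobj (G_ftr K lam) A))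
      = (\<lambda>f\<in>carrier (fst (fobj (G_ftr K lam) A)). f)"
      by (simp add: compose_eq_restrict_iff G_ftr_def eta_def shift_der_funpow hurwitz_map_def
          eps_def hurwitz_alg_def[of _ _ "hurwitz_alg K lam A"])
  next
    fix A B :: "('k, 'a) module" and h
    assume "A \<in> Obj (ALG K)" "B \<in> Obj (ALG K)" "h \<in> Hom (ALG K) A B"
    then show "compose (carrier (fst (fobj (G_ftr K lam) A))) (eps K lam B) (hurwitz_map K lam A h)
        = compose (carrier (fst (fobj (G_ftr K lam) A))) h (eps K lam A)"
      by (simp add: compose_eq_compose_iff G_ftr_def ALG_def eps_def hurwitz_map_def
          hurwitz_alg_def alg_hom_closed)
  qed
qed


section \<open>Coalgebras are differential algebras\<close>

definition coalgebra_derivation :: "('k, 'a) coalg \<Rightarrow> 'a \<Rightarrow> 'a" where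
  "coalgebra_derivation X = (\<lambda>x\<in>carrier (fst X). snd X x 1)"

lemma coalgebra_closed:
  "coalgebra K lam A f \<Longrightarrow> x \<in> carrier A \<Longrightarrow> f x n \<in> carrier A"
  using alg_hom_closed[of f K A "hurwitz_alg K lam A" x]
  by (simp add: coalgebra_def hurwitz_alg_def)

text \<open>
  The case \<open>n = 1\<close> of coassociativity \<open>f x (m + n) = f (f x m) n\<close> is the recursion that defines the
  iterates of \<open>x \<mapsto> f x 1\<close>, and the counit law is its initial value.
\<close>

lemma coalgebra_is_iteration:
  assumes co: "coalgebra K lam A f" and lam: "lam \<in> carrier K" and x: "x \<in> carrier A"
  shows "f x n = (coalgebra_derivation (A, f) ^^ n) x"
proof -
  have A: "algebra K A" using co by (simp add: coalgebra_def)
  interpret weighted_algebra K A lam using A lam by (rule weighted_algebraI)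
  have closed: "f y n \<in> carrier A" if "y \<in> carrier A" for y n
    using co that by (rule coalgebra_closed)
  have counit: "f y 0 = y" if "y \<in> carrier A" for y
    using co that by (simp add: coalgebra_def compose_eq_restrict_iff eps_def closed)
  have coassoc: "f y (m + n) = f (f y m) n" if "y \<in> carrier A" for y m n
  proof -
    have "delta K lam A (f y) = hurwitz_map K lam A f (f y)"
      using co that by (simp add: coalgebra_def compose_eq_compose_iff)
    then have "(\<lambda>m n. f y (m + n)) = (\<lambda>m. f (f y m))"
      using that by (simp add: delta_def eta_def hurwitz_map_def closed shift_der_funpow)
    then show ?thesis by (simp add: fun_eq_iff)
  qed
  show ?thesis
  proof (induction n)
    case 0
    then show ?case by (simp add: counit x)
  next
    case (Suc n)
    have "f x (Suc n) = f (f x n) 1"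
      using coassoc[OF x, of n 1] by simp
    also have "\<dots> = coalgebra_derivation (A, f) (f x n)"
      using closed[OF x, of n] by (simp add: coalgebra_derivation_def)
    finally show ?case
      by (simp add: Suc.IH)
  qed
qed

text \<open>
  The value at \<open>1\<close> of a Hurwitz product is \<open>f 1 g 0 + f 0 g 1 + \<lambda> f 1 g 1\<close>, and \<open>f x 0 = x\<close>; so the
  \<open>\<lambda>\<close>-Leibniz rule is multiplicativity of the structure map, read at \<open>1\<close>. Likewise \<open>d 1 = 0\<close>
  is preservation of the unit, read at \<open>1\<close>.
\<close>

lemma lambda_derivation_of_coalgebra:
  assumes co: "coalgebra K lam A f" and lam: "lam \<in> carrier K"
  shows "lambda_derivation K lam A (coalgebra_derivation (A, f))"
proof -
  have A: "algebra K A" using co by (simp add: coalgebra_def)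
  interpret weighted_algebra K A lam using A lam by (rule weighted_algebraI)
  have closed: "f y n \<in> carrier A" if "y \<in> carrier A" for y n
    using co that by (rule coalgebra_closed)
  have f0: "f y 0 = y" if "y \<in> carrier A" for y
    using coalgebra_is_iteration[OF co lam that, of 0] by simp
  have "f \<in> alg_hom K A (hurwitz_alg K lam A)"
    using co by (simp add: coalgebra_def)
  then show ?thesis
    by (auto simp: lambda_derivation_def coalgebra_derivation_def alg_hom_iff closed
        hurwitz_mult_Suc hurwitz_mult_0 f0)
qed

lemma eta_coalgebra_derivation:
  assumes co: "coalgebra K lam A f" and lam: "lam \<in> carrier K"
  shows "eta (A, coalgebra_derivation (A, f)) = f"
proof
  fix x
  have "f \<in> extensional (carrier A)"
    using co by (auto simp: coalgebra_def alg_hom_def PiE_def)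
  then show "eta (A, coalgebra_derivation (A, f)) x = f x"
    using coalgebra_is_iteration[OF co lam] by (auto simp: eta_def extensional_def fun_eq_iff)
qed

lemma coalgebra_derivation_eta:
  assumes "lambda_derivation K lam R d"
  shows "coalgebra_derivation (R, eta (R, d)) = d"
proof
  fix x
  have "d \<in> extensional (carrier R)"
    using assms by (auto simp: lambda_derivation_def PiE_def)
  then show "coalgebra_derivation (R, eta (R, d)) x = d x"
    by (simp add: coalgebra_derivation_def eta_def extensional_def)
qed

text \<open>
  A coalgebra homomorphism commutes with all iterates, in particular with the first; the converse
  is induction on the number of iterations.
\<close>

lemma dif_hom_eq_coalg_hom:
  assumes lam: "lam \<in> carrier K" and X: "X \<in> Obj (DIF K lam)" and Y: "Y \<in> Obj (DIF K lam)"
  shows "coalg_hom K lam (fst X, eta X) (fst Y, eta Y) = dif_hom K X Y"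
proof (intro equalityI subsetI)
  interpret X: weighted_differential_algebra K "fst X" lam "snd X"
    using X lam by (rule weighted_differential_algebraI)
  fix \<phi>
  {
    assume \<phi>: "\<phi> \<in> dif_hom K X Y"
    then have hom: "\<phi> \<in> alg_hom K (fst X) (fst Y)"
      by (simp add: dif_hom_def)
    then show "\<phi> \<in> coalg_hom K lam (fst X, eta X) (fst Y, eta Y)"
      using dif_hom_iterate[OF \<phi> X.d_closed]
      by (simp add: coalg_hom_def compose_eq_compose_iff eta_def hurwitz_map_def
          alg_hom_closed[OF hom])
  next
    assume \<phi>: "\<phi> \<in> coalg_hom K lam (fst X, eta X) (fst Y, eta Y)"
    then have hom: "\<phi> \<in> alg_hom K (fst X) (fst Y)"
      by (simp add: coalg_hom_def)
    have "\<phi> (snd X x) = snd Y (\<phi> x)" if x: "x \<in> carrier (fst X)" for x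
    proof -
      have "eta Y (\<phi> x) = hurwitz_map K lam (fst X) \<phi> (eta X x)"
        using \<phi> x by (simp add: coalg_hom_def compose_eq_compose_iff)
      then have "(\<lambda>n. (snd Y ^^ n) (\<phi> x)) = (\<lambda>n. \<phi> ((snd X ^^ n) x))"
        using x hom by (simp add: eta_def hurwitz_map_def alg_hom_closed)
      from fun_cong[OF this, of 1] show ?thesis by simp
    qed
    with hom show "\<phi> \<in> dif_hom K X Y"
      by (simp add: dif_hom_iff)
  }
qed

section \<open>The cocomparison functor\<close>

lemma category_ALG_C:
  fixes K :: "('k, 'r) ring_scheme" and lam :: 'k
  shows "category (ALG_C K lam :: (('k, 'a) coalg, 'a \<Rightarrow> 'a) cat)"
proof (rule category_of_extensional_maps[where car = "\<lambda>X. carrier (fst X)"])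
  fix X :: "('k, 'a) coalg" assume "X \<in> Obj (ALG_C K lam)"
  then have co: "coalgebra K lam (fst X) (snd X)"
    by (auto simp: ALG_C_def)
  then show "(\<lambda>x\<in>carrier (fst X). x) \<in> Hom (ALG_C K lam) X X"
    using coalgebra_closed[OF co]
    by (simp add: ALG_C_def coalg_hom_def compose_eq_compose_iff coalgebra_def
        restrict_id_alg_hom hurwitz_map_def hurwitz_alg_def)
next
  fix X Y Z :: "('k, 'a) coalg" and f g
  assume "X \<in> Obj (ALG_C K lam)" "Y \<in> Obj (ALG_C K lam)" "Z \<in> Obj (ALG_C K lam)"
    and f: "f \<in> Hom (ALG_C K lam) X Y" and g: "g \<in> Hom (ALG_C K lam) Y Z"
  then have X: "coalgebra K lam (fst X) (snd X)" and Y: "coalgebra K lam (fst Y) (snd Y)"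
    by (auto simp: ALG_C_def)
  from f g have fh: "f \<in> alg_hom K (fst X) (fst Y)" and gh: "g \<in> alg_hom K (fst Y) (fst Z)"
    by (auto simp: ALG_C_def coalg_hom_def)
  have "snd Z (g (f x)) = hurwitz_map K lam (fst X) (compose (carrier (fst X)) g f) (snd X x)"
    if x: "x \<in> carrier (fst X)" for x
  proof -
    have "snd Z (g (f x)) = hurwitz_map K lam (fst Y) g (snd Y (f x))"
      using g alg_hom_closed[OF fh x]
      by (simp add: ALG_C_def coalg_hom_def compose_eq_compose_iff)
    also have "snd Y (f x) = hurwitz_map K lam (fst X) f (snd X x)"
      using f x by (simp add: ALG_C_def coalg_hom_def compose_eq_compose_iff)
    finally show ?thesis
      using coalgebra_closed[OF X x]
      by (simp add: hurwitz_map_def hurwitz_alg_def compose_eq alg_hom_closed[OF fh])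
  qed
  moreover have "compose (carrier (fst X)) g f \<in> alg_hom K (fst X) (fst Z)"
    using X fh gh by (intro compose_alg_hom) (auto simp: coalgebra_def)
  ultimately show "compose (carrier (fst X)) g f \<in> Hom (ALG_C K lam) X Z"
    by (simp add: ALG_C_def coalg_hom_def compose_eq_compose_iff compose_eq)
qed (auto simp: ALG_C_def coalg_hom_def alg_hom_def)

definition H_inv_ftr :: "(('k, 'a) coalg, 'a \<Rightarrow> 'a, ('k, 'a) dalg, 'a \<Rightarrow> 'a) ftr" where
  "H_inv_ftr = \<lparr> fobj = (\<lambda>X. (fst X, coalgebra_derivation X)), fmap = (\<lambda>X Y \<phi>. \<phi>) \<rparr>"

text \<open>
  Both functors leave the underlying maps unchanged, so it is enough that they are inverse on objects and
  that corresponding hom-sets are equal. For the inverse, equality of hom-sets is obtained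
  from that for \<open>H\<close> by writing a coalgebra as the image of its differential algebra.
\<close>

theorem cocomparison_isomorphism:
  fixes K :: "('k, 'r) ring_scheme" and lam :: 'k
  assumes lam: "lam \<in> carrier K"
  shows "isomorphism_of_categories
           (DIF K lam :: (('k, 'a) dalg, 'a \<Rightarrow> 'a) cat)
           (ALG_C K lam :: (('k, 'a) coalg, 'a \<Rightarrow> 'a) cat) H_ftr"
proof -
  let ?D = "DIF K lam :: (('k, 'a) dalg, 'a \<Rightarrow> 'a) cat"
  let ?C = "ALG_C K lam :: (('k, 'a) coalg, 'a \<Rightarrow> 'a) cat"
  have H_obj: "fobj H_ftr X \<in> Obj ?C" if "X \<in> Obj ?D" for X
    using weighted_differential_algebra.coalgebra_eta[OF weighted_differential_algebraI[OF that lam]]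
    by (simp add: H_ftr_def ALG_C_def)
  have H_inv_obj: "fobj H_inv_ftr X \<in> Obj ?D" if "X \<in> Obj ?C" for X
  proof -
    from that have "coalgebra K lam (fst X) (snd X)"
      by (auto simp: ALG_C_def)
    with lambda_derivation_of_coalgebra[OF this lam] show ?thesis
      by (simp add: H_inv_ftr_def DIF_def coalgebra_def)
  qed
  have H_inv_H: "fobj H_inv_ftr (fobj H_ftr X) = X" if "X \<in> Obj ?D" for X
    using that by (auto simp: H_inv_ftr_def H_ftr_def DIF_def coalgebra_derivation_eta)
  have H_H_inv: "fobj H_ftr (fobj H_inv_ftr X) = X" if "X \<in> Obj ?C" for X
    using that lam by (auto simp: H_inv_ftr_def H_ftr_def ALG_C_def eta_coalgebra_derivation)
  have H_Hom: "Hom ?C (fobj H_ftr X) (fobj H_ftr Y) = Hom ?D X Y"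
    if "X \<in> Obj ?D" "Y \<in> Obj ?D" for X Y
    using dif_hom_eq_coalg_hom[OF lam that] by (simp add: ALG_C_def DIF_def H_ftr_def)
  have H_inv_Hom: "Hom ?D (fobj H_inv_ftr X) (fobj H_inv_ftr Y) = Hom ?C X Y"
    if "X \<in> Obj ?C" "Y \<in> Obj ?C" for X Y
    using H_Hom[OF H_inv_obj[OF that(1)] H_inv_obj[OF that(2)]] that by (simp add: H_H_inv)
  have H: "is_functor ?D ?C H_ftr"
    unfolding is_functor_def
    using H_obj H_Hom
    by (simp add: category_DIF category_ALG_C) (simp add: H_ftr_def DIF_def ALG_C_def)
  have H_inv: "is_functor ?C ?D H_inv_ftr"
    unfolding is_functor_def
    using H_inv_obj H_inv_Hom
    by (simp add: category_DIF category_ALG_C) (simp add: H_inv_ftr_def DIF_def ALG_C_def)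
  have "is_identity_ftr ?D (comp_ftr H_inv_ftr H_ftr)" "is_identity_ftr ?C (comp_ftr H_ftr H_inv_ftr)"
    using H_inv_H H_H_inv
    by (simp_all add: is_identity_ftr_def comp_ftr_def) (simp_all add: H_ftr_def H_inv_ftr_def)
  with H H_inv show ?thesis
    unfolding isomorphism_of_categories_def by blast
qed

theorem theorem3p5:
  fixes K :: "('k, 'r) ring_scheme" and lam :: 'k
  assumes "cring K" and "lam \<in> carrier K"
  shows "isomorphism_of_categories
           (DIF K lam :: (('k, 'a) dalg, 'a \<Rightarrow> 'a) cat)
           (ALG_C K lam :: (('k, 'a) coalg, 'a \<Rightarrow> 'a) cat)
           H_ftr
       \<and> DIF_comonadic_over_ALG K lam TYPE('a)"
  unfolding DIF_comonadic_over_ALG_def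
  using cocomparison_isomorphism[OF assms(2)] forgetful_adjoint_hurwitz[OF assms(2)] by blast

end
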